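(* Let $f:(a,b)\to\mathbb{R}$ be a continuously differentiable uniformly convex function with modulus $\Phi:[0,b-a]\to[0,\infty)$. Let $x_1,\dots,x_n\in(a,b)$ and let $(a_1,\dots,a_n)$ be a nonnegative $n$-tuple with $A_n=\sum_{i=1}^n a_i>0$. Let $\overline{x}=\frac{1}{A_n}\sum_{i=1}^n a_ix_i$ and $\widehat{x}_i=(1-\lambda_i)\overline{x}+\lambda_ix_i$ with $\lambda_i\in[0,1]$, $i=1,\dots,n$. Then $$0\le\left|\frac{1}{A_n}\sum_{i=1}^n a_i\left|f(x_i)-f(\widehat{x}_i)-\Phi\big((1-\lambda_i)|\overline{x}-x_i|\big)\right|-\frac{1}{A_n}\sum_{i=1}^n a_i(1-\lambda_i)|f'(\widehat{x}_i)|\,|\overline{x}-x_i|\right|$$ $$\le\frac{1}{A_n}\sum_{i=1}^n a_if(x_i)-\frac{1}{A_n}\sum_{i=1}^n a_if(\widehat{x}_i)-\frac{1}{A_n}\sum_{i=1}^n a_i(1-\lambda_i)f'(\widehat{x}_i)(\overline{x}-x_i)-\sum_{i=1}^n a_i\Phi\big((1-\lambda_i)|\overline{x}-x_i|\big).$$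
   Context: A function $f$ on an interval with endpoints $a<b$ is uniformly convex with modulus $\Phi:[0,b-a]\to[0,\infty)$ if $tf(x)+(1-t)f(y)\ge f(tx+(1-t)y)+t(1-t)\Phi(|x-y|)$ for all $x,y$ in the interval and all $t\in[0,1]$. By standing convention the modulus $\Phi$ is increasing with $\Phi(0)=0$.
   Formalization: The right-hand side is corrected, since as printed it can be negative: the derivative sum has the factor (x_i − x̄) instead of (x̄ − x_i), and the last sum of the Φ terms is multiplied by 1/A_n. *)

theory Defs
  imports Complex_Main
begin

(* Only the values of the modulus on [0, L] are constrained.  "Increasing" is taken in the
   non-strict sense, which includes the strictly increasing moduli. *)
definition convexity_modulus :: "real \<Rightarrow> (real \<Rightarrow> real) \<Rightarrow> bool" where
  "convexity_modulus L \<Phi> \<longleftrightarrow>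
     (\<forall>r\<in>{0..L}. 0 \<le> \<Phi> r) \<and> mono_on {0..L} \<Phi> \<and> \<Phi> 0 = 0"

(* The set S is meant to be an interval with endpoints a < b and the modulus to be defined
   on [0, b - a], so that \<Phi> is only evaluated inside its domain. *)
definition uniformly_convex_on :: "real set \<Rightarrow> (real \<Rightarrow> real) \<Rightarrow> (real \<Rightarrow> real) \<Rightarrow> bool" where
  "uniformly_convex_on S f \<Phi> \<longleftrightarrow>
     (\<forall>x\<in>S. \<forall>y\<in>S. \<forall>t\<in>{0..1}.
        t * f x + (1 - t) * f y \<ge> f (t * x + (1 - t) * y) + t * (1 - t) * \<Phi> \<bar>x - y\<bar>)"

end

theory Submission
  imports Defs "HOL-Analysis.Convex"
begin

text \<open>
  Letting the convexity parameter tend to 0 turns uniform convexity into the tangent inequality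
  \<open>f x - f y - f' y * (x - y) \<ge> \<Phi> \<bar>x - y\<bar>\<close>. For \<open>y = xhat i\<close> one has
  \<open>x i - y = (1 - lam i) * (x i - xbar)\<close>; writing \<open>p = f x - f y - \<Phi> \<bar>x - y\<bar>\<close> and
  \<open>q = f' y * (x - y)\<close>, the reverse triangle inequality gives \<open>\<bar>\<bar>p\<bar> - \<bar>q\<bar>\<bar> \<le> \<bar>p - q\<bar> = p - q\<close>, and the
  theorem is the weighted average of these inequalities.
\<close>

lemma uniformly_convex_on_imp_above_tangent:
  fixes f :: "real \<Rightarrow> real"
  assumes "uniformly_convex_on S f \<Phi>" and "x \<in> S" "y \<in> S"
    and "(f has_real_derivative D) (at y)"
  shows "D * (x - y) + \<Phi> \<bar>x - y\<bar> \<le> f x - f y"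
proof -
  \<comment> \<open>\<open>f\<close> along the segment from \<open>y\<close> to \<open>x\<close>:
    the derivative of \<open>g\<close> at 0 is the tangent term. Convexity controls only 0 < t < 1,
    so the limit is taken from the right.\<close>
  define g where "g t = f (y + t * (x - y))" for t
  have "(g has_real_derivative D * (x - y)) (at 0)"
    unfolding g_def
    by (rule DERIV_chain2[where f = f]) (use assms(4) in \<open>auto intro!: derivative_eq_intros\<close>)
  hence "((\<lambda>t. (g t - g 0) / t) \<longlongrightarrow> D * (x - y)) (at_right 0)"
    by (auto simp: has_field_derivative_iff intro: tendsto_mono[OF at_le])
  hence lim: "((\<lambda>t. (g t - g 0) / t + (1 - t) * \<Phi> \<bar>x - y\<bar>) \<longlongrightarrow> D * (x - y) + (1 - 0) * \<Phi> \<bar>x - y\<bar>)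
      (at_right 0)"
    by (intro tendsto_intros)
  \<comment> \<open>Convexity at parameter \<open>t\<close>, divided by \<open>t\<close>: the
    modulus keeps the factor \<open>1 - t\<close>, which tends to 1, so all of \<open>\<Phi>\<close>
    survives in the limit.\<close>
  have "(g t - g 0) / t + (1 - t) * \<Phi> \<bar>x - y\<bar> \<le> f x - f y" if "0 < t" "t < 1" for t
  proof -
    have "f (t * x + (1 - t) * y) + t * (1 - t) * \<Phi> \<bar>x - y\<bar> \<le> t * f x + (1 - t) * f y"
      using assms(1-3) that by (auto simp: uniformly_convex_on_def)
    moreover have "t * x + (1 - t) * y = y + t * (x - y)"
      by (simp add: algebra_simps)
    ultimately have "g t - g 0 + t * ((1 - t) * \<Phi> \<bar>x - y\<bar>) \<le> t * (f x - f y)"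
      by (simp add: g_def algebra_simps)
    thus ?thesis
      using that by (simp add: field_simps)
  qed
  hence "\<forall>\<^sub>F t in at_right 0. (g t - g 0) / t + (1 - t) * \<Phi> \<bar>x - y\<bar> \<le> f x - f y"
    by (auto simp: eventually_at_right_field intro!: exI[of _ 1])
  from tendsto_upperbound[OF lim this] show ?thesis
    by simp
qed

text \<open>Triangle inequality with nonnegative weights; it carries termwise bounds over to the
  averages.\<close>

lemma abs_weighted_sum_le:
  fixes w u v :: "'i \<Rightarrow> real"
  assumes "\<And>i. i \<in> I \<Longrightarrow> 0 \<le> w i" and "\<And>i. i \<in> I \<Longrightarrow> \<bar>u i\<bar> \<le> v i"
  shows "\<bar>\<Sum>i\<in>I. w i * u i\<bar> \<le> (\<Sum>i\<in>I. w i * v i)"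
  by (rule order_trans[OF sum_abs sum_mono]) (simp add: abs_mult assms mult_left_mono)

text \<open>Unlike in the informal statement, the derivative term has \<open>x i - xbar\<close> and
  the last sum the factor \<open>1 / A\<close>: averaging the tangent inequalities at
  \<open>xhat i\<close> gives this form.\<close>

theorem theorem8:
  fixes a b :: real and f f' \<Phi> :: "real \<Rightarrow> real"
    and n :: nat and x w lam xhat :: "nat \<Rightarrow> real" and A xbar :: real
  assumes "a < b"
    and "\<And>u. u \<in> {a<..<b} \<Longrightarrow> (f has_real_derivative f' u) (at u)"
    and "continuous_on {a<..<b} f'"
    and "convexity_modulus (b - a) \<Phi>"
    and "uniformly_convex_on {a<..<b} f \<Phi>"
    and "\<And>i. i \<in> {1..n} \<Longrightarrow> x i \<in> {a<..<b}"
    and "\<And>i. i \<in> {1..n} \<Longrightarrow> 0 \<le> w i"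
    and "A = (\<Sum>i=1..n. w i)"
    and "A > 0"
    and "xbar = (1 / A) * (\<Sum>i=1..n. w i * x i)"
    and "\<And>i. i \<in> {1..n} \<Longrightarrow> lam i \<in> {0..1}"
    and "\<And>i. i \<in> {1..n} \<Longrightarrow> xhat i = (1 - lam i) * xbar + lam i * x i"
  shows "0 \<le> \<bar>(1 / A) * (\<Sum>i=1..n. w i * \<bar>f (x i) - f (xhat i) - \<Phi> ((1 - lam i) * \<bar>xbar - x i\<bar>)\<bar>)
              - (1 / A) * (\<Sum>i=1..n. w i * (1 - lam i) * \<bar>f' (xhat i)\<bar> * \<bar>xbar - x i\<bar>)\<bar>
       \<and> \<bar>(1 / A) * (\<Sum>i=1..n. w i * \<bar>f (x i) - f (xhat i) - \<Phi> ((1 - lam i) * \<bar>xbar - x i\<bar>)\<bar>)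
              - (1 / A) * (\<Sum>i=1..n. w i * (1 - lam i) * \<bar>f' (xhat i)\<bar> * \<bar>xbar - x i\<bar>)\<bar>
         \<le> (1 / A) * (\<Sum>i=1..n. w i * f (x i)) - (1 / A) * (\<Sum>i=1..n. w i * f (xhat i))
            - (1 / A) * (\<Sum>i=1..n. w i * (1 - lam i) * f' (xhat i) * (x i - xbar))
            - (1 / A) * (\<Sum>i=1..n. w i * \<Phi> ((1 - lam i) * \<bar>xbar - x i\<bar>))"
proof -
  \<comment> \<open>\<open>xbar\<close> is a convex combination of the \<open>x i\<close> with
    weights \<open>w i / A\<close>.\<close>
  have "(\<Sum>i=1..n. (w i / A) *\<^sub>R x i) \<in> {a<..<b}"
  proof (rule convex_sum)
    show "(\<Sum>i=1..n. w i / A) = 1"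
      using assms(8,9) by (simp flip: sum_divide_distrib)
  qed (use assms in auto)
  hence xbar: "xbar \<in> {a<..<b}"
    by (simp add: assms(10) sum_distrib_left field_simps)
  let ?\<Phi> = "\<lambda>i. \<Phi> ((1 - lam i) * \<bar>xbar - x i\<bar>)"
  let ?u = "\<lambda>i. \<bar>f (x i) - f (xhat i) - ?\<Phi> i\<bar> - (1 - lam i) * \<bar>f' (xhat i)\<bar> * \<bar>xbar - x i\<bar>"
  let ?v = "\<lambda>i. f (x i) - f (xhat i) - (1 - lam i) * f' (xhat i) * (x i - xbar) - ?\<Phi> i"
  have term_le: "\<bar>?u i\<bar> \<le> ?v i" if i: "i \<in> {1..n}" for i
  proof -
    have lam: "0 \<le> lam i" "lam i \<le> 1"
      using assms(11)[OF i] by auto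
    have "(1 - lam i) *\<^sub>R xbar + lam i *\<^sub>R x i \<in> {a<..<b}"
      by (rule convexD[OF _ xbar assms(6)[OF i]]) (use lam in auto)
    hence xhat: "xhat i \<in> {a<..<b}"
      by (simp add: assms(12)[OF i])
    have diff: "x i - xhat i = (1 - lam i) * (x i - xbar)"
      by (simp add: assms(12)[OF i] algebra_simps)
    \<comment> \<open>Since \<open>1 - lam i\<close> is nonnegative, the argument of
      \<open>\<Phi>\<close> is exactly the distance from \<open>x i\<close> to
      \<open>xhat i\<close>.\<close>
    have dist: "\<bar>x i - xhat i\<bar> = (1 - lam i) * \<bar>xbar - x i\<bar>"
      using lam by (simp add: diff abs_mult abs_minus_commute)
    define q where "q = f' (xhat i) * (x i - xhat i)"
    have tangent: "q + ?\<Phi> i \<le> f (x i) - f (xhat i)"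
      using uniformly_convex_on_imp_above_tangent[OF assms(5) assms(6)[OF i] xhat assms(2)[OF xhat]]
      by (simp add: q_def dist)
    have q: "(1 - lam i) * f' (xhat i) * (x i - xbar) = q"
      by (simp add: q_def diff)
    have abs_q: "(1 - lam i) * \<bar>f' (xhat i)\<bar> * \<bar>xbar - x i\<bar> = \<bar>q\<bar>"
      by (simp add: q_def abs_mult dist)
    show ?thesis
      unfolding q abs_q using tangent by linarith
  qed
  have "\<bar>\<Sum>i=1..n. w i * ?u i\<bar> \<le> (\<Sum>i=1..n. w i * ?v i)"
    using assms(7) term_le by (rule abs_weighted_sum_le)
  \<comment> \<open>As \<open>A\<close> is positive, \<open>1 / A\<close> moves inside the absolute
    value; linearity of the sums then gives the claim.\<close>
  hence "\<bar>1 / A * (\<Sum>i=1..n. w i * ?u i)\<bar> \<le> 1 / A * (\<Sum>i=1..n. w i * ?v i)"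
    using assms(9) by (simp add: abs_mult divide_right_mono)
  thus ?thesis
    by (simp add: algebra_simps sum_subtractf sum.distrib diff_divide_distrib add_divide_distrib)
qed

end
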